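(* Let $H$ be a graph of order $n'$. If $H\not\cong N_{n'}$ and $H\not\cong K_{n'}$, then for any integer $n\ge 2$, $$\gamma_{\rm sp}(N_n+H)=\min\{\,n'+n-2,\ n+\gamma_{\rm sp}(H)\,\}.$$
   Context: All graphs are finite, simple and undirected, with nonempty vertex set; the order of a graph is its number of vertices. $K_m$ and $N_m$ are the complete graph and the empty (edgeless) graph of order $m$. For a vertex $v$ of $G$, $N(v)$ is the set of vertices adjacent to $v$, and for $D\subseteq V(G)$, $\overline{D}=V(G)\setminus D$. A set $D\subseteq V(G)$ is a super dominating set of $G$ if for every $u\in\overline{D}$ there exists $v\in D$ such that $N(v)\cap\overline{D}=\{u\}$. The super domination number $\gamma_{\rm sp}(G)$ is the minimum cardinality of a super dominating set of $G$. The join $G+H$ is the graph obtained from disjoint copies of $G$ and $H$ by joining by an edge each vertex of $G$ with each vertex of $H$. *)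

theory Defs
  imports "Graph_Theory.Graph_Theory"
begin

text \<open>
  A finite simple undirected graph is a graph \<open>G\<close> with \<^const>\<open>pair_graph\<close> \<open>G\<close>: a finite vertex set
  together with a symmetric irreflexive set of arcs, an undirected edge \<open>uv\<close> being
  the pair of arcs \<open>(u, v)\<close>, \<open>(v, u)\<close>. The library admits the null graph, so nonemptiness of
  the vertex set has to be required separately. Isomorphism is \<^const>\<open>digraph_iso\<close>, applied
  through the coercion \<^const>\<open>with_proj\<close>.
\<close>

definition empty_graph :: "nat \<Rightarrow> nat pair_pre_digraph" where
  "empty_graph m = \<lparr> pverts = {..<m}, parcs = {} \<rparr>"

definition complete_graph :: "nat \<Rightarrow> nat pair_pre_digraph" where
  "complete_graph m = \<lparr> pverts = {..<m}, parcs = {(u, v). u < m \<and> v < m \<and> u \<noteq> v} \<rparr>"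

definition graph_join ::
  "'a pair_pre_digraph \<Rightarrow> 'b pair_pre_digraph \<Rightarrow> ('a + 'b) pair_pre_digraph" where
  "graph_join G H =
     \<lparr> pverts = pverts G <+> pverts H,
       parcs = {(Inl u, Inl v) | u v. (u, v) \<in> parcs G}
             \<union> {(Inr u, Inr v) | u v. (u, v) \<in> parcs H}
             \<union> {(Inl u, Inr v) | u v. u \<in> pverts G \<and> v \<in> pverts H}
             \<union> {(Inr v, Inl u) | u v. u \<in> pverts G \<and> v \<in> pverts H} \<rparr>"

definition neighbourhood :: "'a pair_pre_digraph \<Rightarrow> 'a \<Rightarrow> 'a set" where
  "neighbourhood G v = {u \<in> pverts G. (v, u) \<in> parcs G}"

definition super_dominating :: "'a pair_pre_digraph \<Rightarrow> 'a set \<Rightarrow> bool" where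
  "super_dominating G D \<longleftrightarrow>
     D \<subseteq> pverts G \<and>
     (\<forall>u \<in> pverts G - D. \<exists>v \<in> D. neighbourhood G v \<inter> (pverts G - D) = {u})"

definition super_domination_number :: "'a pair_pre_digraph \<Rightarrow> nat" where
  "super_domination_number G = Min (card ` {D. super_dominating G D})"

text \<open>
  For finite \<open>G\<close> the minimum is over a finite nonempty set, hence attained.
\<close>

lemma super_dominating_pverts: "super_dominating G (pverts G)"
  by (simp add: super_dominating_def)

lemma finite_super_dominating:
  assumes "finite (pverts G)"
  shows "finite {D. super_dominating G D}"
  by (rule finite_subset[of _ "Pow (pverts G)"]) (use assms in \<open>auto simp: super_dominating_def\<close>)

lemma pair_graph_empty_graph: "pair_graph (empty_graph m)"
  by unfold_locales (auto simp: empty_graph_def symmetric_def sym_def)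

lemma complete_digraph_complete_graph: "complete_digraph m (complete_graph m)"
  by (auto simp: complete_digraph_pair_def complete_graph_def)

lemma pair_graph_graph_join:
  assumes "pair_graph G" and "pair_graph H"
  shows "pair_graph (graph_join G H)"
proof -
  interpret G: pair_graph G by fact
  interpret H: pair_graph H by fact
  have verts: "parcs (graph_join G H) \<subseteq> pverts (graph_join G H) \<times> pverts (graph_join G H)"
    by (auto simp: graph_join_def dest: G.in_arcsD1 G.in_arcsD2 H.in_arcsD1 H.in_arcsD2)
  have fin: "finite (pverts (graph_join G H))"
    by (simp add: graph_join_def G.pair_finite_verts H.pair_finite_verts)
  have "sym (parcs G)" "sym (parcs H)"
    using G.pair_sym_arcs H.pair_sym_arcs by (simp_all add: symmetric_def)
  then have sym: "sym (parcs (graph_join G H))"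
    by (auto simp: graph_join_def sym_def)
  show ?thesis
  proof unfold_locales
    show "finite (parcs (graph_join G H))"
      using verts fin by (meson finite_SigmaI finite_subset)
    show "fst e \<noteq> snd e" if "e \<in> parcs (graph_join G H)" for e
      using that by (auto simp: graph_join_def dest: G.pair_no_loops H.pair_no_loops)
  qed (use verts fin sym in \<open>auto simp: symmetric_def\<close>)
qed

end

theory Submission
  imports Defs
begin

text \<open>
  Read a super dominating set \<open>D\<close> through its complement \<open>C\<close>: every vertex of \<open>C\<close> needs a neighbour
  in \<open>D\<close> that sees no other vertex of \<open>C\<close>. In the join of \<open>N\<^sub>n\<close> and \<open>H\<close> the two kinds of vertices
  are very restricted as such private dominators. A vertex of \<open>N\<^sub>n\<close> sees exactly the vertices of
  \<open>H\<close>, so it can serve only if \<open>C\<close> contains a single vertex of \<open>H\<close>. A vertex of \<open>H\<close> sees all of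
  \<open>N\<^sub>n\<close>, so it can serve a vertex of \<open>H\<close> only if \<open>C\<close> avoids \<open>N\<^sub>n\<close>.

  Hence there are two regimes. If \<open>C\<close> meets \<open>N\<^sub>n\<close>, it contains at most one vertex on either side, so
  \<open>|C| \<le> 2\<close> and \<open>|D| \<ge> n' + n - 2\<close>. If \<open>C\<close> lies inside \<open>H\<close> and has at least two vertices, all
  private dominators lie in \<open>H\<close>, so \<open>D\<close> is \<open>N\<^sub>n\<close> together with a super dominating set of \<open>H\<close>, and
  \<open>|D| \<ge> n + \<gamma>\<^sub>s\<^sub>p(H)\<close>. Both values are attained. The second one is immediate. For the first,
  non-completeness of \<open>H\<close> supplies distinct nonadjacent vertices \<open>b\<close> and \<open>v\<close>, and one may leave out
  \<open>b\<close> and one vertex \<open>a\<close> of \<open>N\<^sub>n\<close>: \<open>v\<close> privately dominates \<open>a\<close>, and a second vertex of \<open>N\<^sub>n\<close>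
  privately dominates \<open>b\<close>.
\<close>

lemma super_dominatingE:
  assumes "super_dominating G D" and "u \<in> pverts G - D"
  obtains v where "v \<in> D" and "neighbourhood G v \<inter> (pverts G - D) = {u}"
  using assms unfolding super_dominating_def by (elim conjE bspec[elim_format] bexE)

lemma super_domination_number_le:
  assumes "finite (pverts G)" and "super_dominating G D"
  shows "super_domination_number G \<le> card D"
  unfolding super_domination_number_def
  using assms by (intro Min_le) (auto simp: finite_super_dominating)

lemma super_domination_number_attained:
  assumes "finite (pverts G)"
  obtains D where "super_dominating G D" and "card D = super_domination_number G"
proof -
  have "super_domination_number G \<in> card ` {D. super_dominating G D}"
    unfolding super_domination_number_def
    using assms super_dominating_pverts by (intro Min_in) (auto simp: finite_super_dominating)
  then show thesis
    using that by auto
qed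

text \<open>
  When all arcs are present, every numbering of the vertices is an isomorphism. The contrapositive
  supplies two distinct nonadjacent vertices of a graph that is not complete.
\<close>

lemma digraph_iso_complete_graph:
  fixes H :: "'a pair_pre_digraph"
  assumes "pair_graph H"
    and adj: "\<And>u v. u \<in> pverts H \<Longrightarrow> v \<in> pverts H \<Longrightarrow> u \<noteq> v \<Longrightarrow> (u, v) \<in> parcs H"
  shows "digraph_iso H (complete_graph (card (pverts H)))"
proof -
  interpret pair_graph H by fact
  obtain f where f: "bij_betw f (pverts H) {..<card (pverts H)}"
    using ex_bij_betw_finite_nat[OF pair_finite_verts] by (auto simp: atLeast0LessThan)
  then have inj: "inj_on f (pverts H)" and img: "f ` pverts H = {..<card (pverts H)}"
    by (auto simp: bij_betw_def)
  have arcs: "parcs H = {(u, v). u \<in> pverts H \<and> v \<in> pverts H \<and> u \<noteq> v}"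
    using adj by (auto dest: in_arcsD1 in_arcsD2 pair_no_loops)
  define g where "g = \<lparr>iso_verts = f, iso_arcs = map_prod f f, iso_head = snd, iso_tail = fst\<rparr>"
  have "map_prod f f ` parcs H
      = {(i, j). i < card (pverts H) \<and> j < card (pverts H) \<and> i \<noteq> j}"
    (is "_ = ?R")
  proof
    show "map_prod f f ` parcs H \<subseteq> ?R"
      using inj img unfolding arcs by (auto dest: inj_onD)
    show "?R \<subseteq> map_prod f f ` parcs H"
    proof clarify
      fix i j assume "i < card (pverts H)" "j < card (pverts H)" "i \<noteq> j"
      moreover from this obtain u v where "u \<in> pverts H" "v \<in> pverts H" "i = f u" "j = f v"
        using img by (metis imageE lessThan_iff)
      ultimately show "(i, j) \<in> map_prod f f ` parcs H"
        unfolding arcs by force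
    qed
  qed
  then have "with_proj (complete_graph (card (pverts H))) = app_iso g (with_proj H)"
    using img by (simp add: app_iso_def g_def with_proj_def complete_graph_def)
  moreover have "inj_on (map_prod f f) (parcs H)"
    using inj unfolding arcs by (auto intro!: inj_onI dest: inj_onD)
  then have "digraph_isomorphism g"
    using inj wf_digraph_axioms by (auto simp: digraph_isomorphism_def g_def)
  ultimately show ?thesis
    unfolding digraph_iso_def by blast
qed

lemma pverts_join_empty_graph:
  "pverts (graph_join (empty_graph n) H) = {..<n} <+> pverts H"
  by (simp add: graph_join_def empty_graph_def)

lemma neighbourhood_join_Inl:
  "i < n \<Longrightarrow> neighbourhood (graph_join (empty_graph n) H) (Inl i) = Inr ` pverts H"
  by (auto simp: neighbourhood_def graph_join_def empty_graph_def)

lemma neighbourhood_join_Inr: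
  "v \<in> pverts H \<Longrightarrow> neighbourhood (graph_join (empty_graph n) H) (Inr v)
     = Inl ` {..<n} \<union> Inr ` neighbourhood H v"
  by (auto simp: neighbourhood_def graph_join_def empty_graph_def)

text \<open>
  Keeping all of \<open>N\<^sub>n\<close> leaves only vertices of \<open>H\<close> to be dominated, and on those the neighbourhoods of
  vertices of \<open>H\<close> are the same in the join as in \<open>H\<close>.
\<close>

lemma super_dominating_join_extend:
  assumes "super_dominating H S"
  shows "super_dominating (graph_join (empty_graph n) H) ({..<n} <+> S)"
proof -
  have S: "S \<subseteq> pverts H"
    using assms by (simp add: super_dominating_def)
  have compl: "({..<n} <+> pverts H) - ({..<n} <+> S) = Inr ` (pverts H - S)"
    by auto
  show ?thesis
    unfolding super_dominating_def pverts_join_empty_graph compl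
  proof (intro conjI ballI)
    fix x :: "nat + 'a" assume "x \<in> Inr ` (pverts H - S)"
    then obtain u where u: "x = Inr u" "u \<in> pverts H - S" by auto
    obtain v where "v \<in> S" "neighbourhood H v \<inter> (pverts H - S) = {u}"
      using assms u(2) by (rule super_dominatingE)
    moreover from this have "v \<in> pverts H"
      using S by blast
    ultimately have "neighbourhood (graph_join (empty_graph n) H) (Inr v) \<inter> Inr ` (pverts H - S) = {x}"
      using u by (auto simp: neighbourhood_join_Inr)
    with \<open>v \<in> S\<close> show "\<exists>y \<in> {..<n} <+> S.
        neighbourhood (graph_join (empty_graph n) H) y \<inter> Inr ` (pverts H - S) = {x}"
      by (intro bexI[of _ "Inr v"]) auto
  qed (use S in auto)
qed

text \<open>
  The two omitted vertices are dominated crosswise: \<open>Inl 0\<close> by \<open>Inr v\<close>, which misses \<open>Inr b\<close>, and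
  \<open>Inr b\<close> by \<open>Inl 1\<close>, which misses \<open>Inl 0\<close>. The latter is where \<open>n \<ge> 2\<close> enters.
\<close>

lemma super_dominating_join_omit_two:
  assumes "n \<ge> 2" and b: "b \<in> pverts H" and v: "v \<in> pverts H"
    and "b \<noteq> v" and nonadj: "(v, b) \<notin> parcs H"
  shows "super_dominating (graph_join (empty_graph n) H) (({..<n} <+> pverts H) - {Inl 0, Inr b})"
    (is "super_dominating ?J ?D")
proof -
  have compl: "({..<n} <+> pverts H) - ?D = {Inl 0, Inr b}"
    using assms by auto
  have "b \<notin> neighbourhood H v"
    using nonadj by (simp add: neighbourhood_def)
  then have "neighbourhood ?J (Inr v) \<inter> {Inl 0, Inr b} = {Inl 0}"
    using assms by (auto simp: neighbourhood_join_Inr)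
  moreover have "neighbourhood ?J (Inl 1) \<inter> {Inl 0, Inr b} = {Inr b}"
    using assms by (auto simp: neighbourhood_join_Inl)
  moreover have "Inr v \<in> ?D" "Inl 1 \<in> ?D"
    using assms by auto
  ultimately have "\<exists>y \<in> ?D. neighbourhood ?J y \<inter> {Inl 0, Inr b} = {x}"
    if "x \<in> {Inl 0, Inr b}" for x
    using that by (auto intro: bexI[of _ "Inr v"] bexI[of _ "Inl 1"])
  then show ?thesis
    unfolding super_dominating_def pverts_join_empty_graph compl by blast
qed

text \<open>
  A vertex of \<open>N\<^sub>n\<close> can only be dominated from \<open>H\<close>, by a vertex that sees every other omitted vertex
  of \<open>N\<^sub>n\<close> as well; so only one is omitted. Once it is, vertices of \<open>H\<close> can only be dominated from
  \<open>N\<^sub>n\<close>, by a vertex that sees all of \<open>H\<close>.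
\<close>

lemma card_omitted_le_2:
  assumes sd: "super_dominating (graph_join (empty_graph n) H) D"
    and a: "Inl a \<in> ({..<n} <+> pverts H) - D"
  shows "card (({..<n} <+> pverts H) - D) \<le> 2"
proof -
  let ?N = "neighbourhood (graph_join (empty_graph n) H)"
  define C where "C = ({..<n} <+> pverts H) - D"
  have D: "D \<subseteq> {..<n} <+> pverts H"
    using sd by (simp add: super_dominating_def pverts_join_empty_graph)
  have priv: "\<exists>y \<in> D. ?N y \<inter> C = {x}" if "x \<in> C" for x
    using super_dominatingE[OF sd, of x] that unfolding pverts_join_empty_graph C_def[symmetric]
    by metis
  have C: "C \<subseteq> {..<n} <+> pverts H" and aC: "Inl a \<in> C"
    using a by (auto simp: C_def)
  have left: "i = a" if i: "Inl i \<in> C" for i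
  proof -
    obtain y where "y \<in> D" and y: "?N y \<inter> C = {Inl i}"
      using priv[OF i] by (elim bexE)
    then have "Inl i \<in> ?N y" "y \<in> {..<n} <+> pverts H"
      using D by auto
    then obtain v where "y = Inr v" "v \<in> pverts H"
      by (auto simp: neighbourhood_join_Inl)
    then have "Inl a \<in> ?N y"
      using C aC by (auto simp: neighbourhood_join_Inr)
    then have "Inl a \<in> ?N y \<inter> C"
      using aC by simp
    then show ?thesis
      unfolding y by simp
  qed
  have right: "b = c" if bc: "Inr b \<in> C" "Inr c \<in> C" for b c
  proof -
    obtain y where "y \<in> D" and y: "?N y \<inter> C = {Inr b}"
      using priv[OF bc(1)] by (elim bexE)
    have "Inl a \<notin> ?N y \<inter> C"
      unfolding y by simp
    then have "Inl a \<notin> ?N y" "y \<in> {..<n} <+> pverts H"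
      using aC \<open>y \<in> D\<close> D by auto
    then obtain i where "y = Inl i" "i < n"
      using C aC by (auto simp: neighbourhood_join_Inr)
    then have "Inr c \<in> ?N y"
      using C bc by (auto simp: neighbourhood_join_Inl)
    then have "Inr c \<in> ?N y \<inter> C"
      using bc by simp
    then show ?thesis
      unfolding y by simp
  qed
  have "\<exists>z. C \<subseteq> {Inl a, z}"
  proof (cases "\<exists>b. Inr b \<in> C")
    case True
    then obtain b where "Inr b \<in> C" by blast
    have "x \<in> {Inl a, Inr b}" if "x \<in> C" for x
      using that left right[OF \<open>Inr b \<in> C\<close>] by (cases x) auto
    then show ?thesis by blast
  next
    case False
    have "x \<in> {Inl a, Inl a}" if "x \<in> C" for x
      using that left False by (cases x) auto
    then show ?thesis by blast
  qed
  then obtain z where "C \<subseteq> {Inl a, z}" by blast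
  then have "card C \<le> card {Inl a, z}"
    by (intro card_mono) auto
  also have "\<dots> \<le> 2"
    by (simp add: card_insert_if)
  finally show ?thesis
    by (simp add: C_def)
qed

text \<open>
  With two vertices of \<open>H\<close> omitted, no vertex of \<open>N\<^sub>n\<close> is a private dominator, so the domination
  takes place inside \<open>H\<close>.
\<close>

lemma super_dominating_join_restrict:
  assumes sd: "super_dominating (graph_join (empty_graph n) H) ({..<n} <+> S)"
    and two: "card (pverts H - S) \<ge> 2"
  shows "super_dominating H S"
proof -
  let ?N = "neighbourhood (graph_join (empty_graph n) H)"
  have compl: "pverts (graph_join (empty_graph n) H) - ({..<n} <+> S) = Inr ` (pverts H - S)"
    by (auto simp: pverts_join_empty_graph)
  have S: "S \<subseteq> pverts H"
    using sd by (auto simp: super_dominating_def pverts_join_empty_graph)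
  have "\<exists>v \<in> S. neighbourhood H v \<inter> (pverts H - S) = {u}" if u: "u \<in> pverts H - S" for u
  proof -
    have "Inr u \<in> pverts (graph_join (empty_graph n) H) - ({..<n} <+> S)"
      using u by (auto simp: pverts_join_empty_graph)
    with sd obtain y where "y \<in> {..<n} <+> S" and y: "?N y \<inter> Inr ` (pverts H - S) = {Inr u}"
      unfolding compl[symmetric] by (rule super_dominatingE)
    then consider i where "y = Inl i" "i < n" | v where "y = Inr v" "v \<in> S"
      by auto
    then show ?thesis
    proof cases
      case 1
      then have "Inr ` (pverts H - S) = (Inr ` {u} :: (nat + 'a) set)"
        using y by (auto simp: neighbourhood_join_Inl)
      then have "pverts H - S = {u}"
        by (simp only: inj_image_eq_iff[OF inj_Inr])
      with two show ?thesis
        by simp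
    next
      case 2
      then have "v \<in> pverts H"
        using S by blast
      with 2 have "?N y \<inter> Inr ` (pverts H - S) = Inr ` (neighbourhood H v \<inter> (pverts H - S))"
        by (auto simp: neighbourhood_join_Inr)
      then have "Inr ` (neighbourhood H v \<inter> (pverts H - S)) = (Inr ` {u} :: (nat + 'a) set)"
        using y by simp
      then have "neighbourhood H v \<inter> (pverts H - S) = {u}"
        by (simp only: inj_image_eq_iff[OF inj_Inr])
      with 2 show ?thesis
        by blast
    qed
  qed
  with S show ?thesis
    by (simp add: super_dominating_def)
qed

theorem theorem24:
  fixes H :: "'a pair_pre_digraph" and n n' :: nat
  assumes "pair_graph H" and "pverts H \<noteq> {}" and "card (pverts H) = n'"
    and "\<not> digraph_iso H (empty_graph n')"
    and "\<not> digraph_iso H (complete_graph n')"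
    and "n \<ge> 2"
  shows "super_domination_number (graph_join (empty_graph n) H)
           = min (n' + n - 2) (n + super_domination_number H)"
proof (rule antisym)
  let ?J = "graph_join (empty_graph n) H"
  let ?V = "{..<n} <+> pverts H :: (nat + 'a) set"
  interpret pair_graph H by fact
  have fin: "finite ?V" and finJ: "finite (pverts ?J)"
    by (simp_all add: pverts_join_empty_graph)
  have cardV: "card ?V = n + n'"
    using assms by (simp add: card_Plus)

  obtain b v where bv: "b \<in> pverts H" "v \<in> pverts H" "b \<noteq> v" "(v, b) \<notin> parcs H"
    using digraph_iso_complete_graph[of H] assms by metis
  have "card (?V - {Inl 0, Inr b}) = n' + n - 2"
    using bv \<open>n \<ge> 2\<close> cardV by (subst card_Diff_subset) auto
  then have "super_domination_number ?J \<le> n' + n - 2"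
    using super_domination_number_le[OF finJ super_dominating_join_omit_two[OF \<open>n \<ge> 2\<close> bv]]
    by simp
  moreover obtain S where S: "super_dominating H S" "card S = super_domination_number H"
    using super_domination_number_attained[OF pair_finite_verts] by blast
  have "finite S"
    using S by (auto simp: super_dominating_def intro: finite_subset)
  then have "super_domination_number ?J \<le> n + super_domination_number H"
    using super_domination_number_le[OF finJ super_dominating_join_extend[OF S(1)]] S
    by (simp add: card_Plus)
  ultimately show "super_domination_number ?J \<le> min (n' + n - 2) (n + super_domination_number H)"
    by simp

  obtain D where sd: "super_dominating ?J D" and cardD: "card D = super_domination_number ?J"
    using super_domination_number_attained[OF finJ] by blast
  have D: "D \<subseteq> ?V"
    using sd by (simp add: super_dominating_def pverts_join_empty_graph)
  have "card (?V - D) = n + n' - card D"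
    using D fin cardV by (simp add: card_Diff_subset finite_subset)
  then have small: "n' + n - 2 \<le> card D" if "card (?V - D) \<le> 2"
    using that by linarith
  show "min (n' + n - 2) (n + super_domination_number H) \<le> super_domination_number ?J"
  proof (cases "card (?V - D) \<le> 2")
    case True
    then show ?thesis
      using small cardD by simp
  next
    case False
    define S where "S = {u. Inr u \<in> D}"
    \<comment> \<open>More than two omitted vertices force all of \<open>N\<^sub>n\<close> into \<open>D\<close>.\<close>
    have "Inl i \<in> D" if "i < n" for i
      using card_omitted_le_2[OF sd, of i] False that by auto
    then have DS: "D = {..<n} <+> S"
      using D by (auto simp: S_def)
    have "?V - D = Inr ` (pverts H - S)"
      unfolding DS by auto
    then have "card (?V - D) = card (pverts H - S)"
      by (simp add: card_image)
    then have "super_dominating H S"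
      using super_dominating_join_restrict sd False unfolding DS by fastforce
    moreover have "finite S"
      using D fin DS by (metis finite_Plus_iff finite_subset)
    ultimately have "n + super_domination_number H \<le> card D"
      using super_domination_number_le[OF pair_finite_verts] unfolding DS by (simp add: card_Plus)
    then show ?thesis
      using cardD by simp
  qed
qed

end
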